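(* Let $(\Xi,\rho,\theta,\Sigma)$ be a continuous groupoid action with $\Xi$ strongly non-compact, and let $\Sigma_{\rm nw}\subset\Sigma$ be the set of its non-wandering points. If $\Sigma$ is compact, $\Sigma_{\rm nw}$ attracts the points of $\Sigma$: for every $\sigma\in\Sigma$ and for every neighborhood $V$ of $\Sigma_{\rm nw}$, one has $\xi\bullet\sigma\in V$ for every $\xi\in\Xi_{\rho(\sigma)}$ outside some compact set.
   Context: All topological spaces are Hausdorff. A groupoid $\Xi$ is a small category in which all arrows are invertible; $X=\Xi^{(0)}$ is its unit space, $d,r:\Xi\to X$ are the source and range maps, and $\xi\eta$ is defined iff $d(\xi)=r(\eta)$. A topological groupoid is a groupoid with a (Hausdorff) topology making inversion and multiplication continuous (composable pairs carry the topology induced from $\Xi\times\Xi$); $X$ has the subspace topology. For $x\in X$, $\Xi_x=d^{-1}(\{x\})$. $\Xi$ is strongly non-compact if $\Xi_x$ is non-compact for every $x\in X$. A continuous groupoid action $(\Xi,\rho,\theta,\Sigma)$ consists of a topological groupoid $\Xi$, a Hausdorff space $\Sigma$, a continuous surjection $\rho:\Sigma\to X$ (the anchor) and a continuous map $\theta:\{(\xi,\sigma)\in\Xi\times\Sigma: d(\xi)=\rho(\sigma)\}\to\Sigma$, $\theta_\xi(\sigma)=\xi\bullet\sigma$, with $\rho(\sigma)\bullet\sigma=\sigma$ and: if $d(\xi)=r(\eta)$ and $d(\eta)=\rho(\sigma)$ then $d(\xi)=\rho(\eta\bullet\sigma)$ and $(\xi\eta)\bullet\sigma=\xi\bullet(\eta\bullet\sigma)$.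 For $M\subset\Sigma$, $\xi\bullet M=\{\xi\bullet\sigma:\sigma\in M,\ \rho(\sigma)=d(\xi)\}$. The recurrence set is $\widetilde\Xi_M^N=\{\xi\in\Xi:(\xi\bullet M)\cap N\neq\emptyset\}$ for $M,N\subset\Sigma$. A point $\sigma\in\Sigma$ is wandering if it has a neighborhood $W$ such that $\widetilde\Xi_W^W$ is relatively compact (has compact closure) in $\Xi$; otherwise it is non-wandering. *)

theory Defs
  imports "HOL-Analysis.Analysis"
begin

text \<open>
  A small category with invertible arrows is given by its arrows alone: the objects are identified
  with their identity arrows, so that the unit space is a subset of the set of arrows.
  The set of arrows is the carrier of the topology \<open>arrows\<close>, and \<open>mult \<xi> \<eta>\<close> is meaningful only
  if \<open>src \<xi> = rng \<eta>\<close>.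
\<close>

record 'g groupoid_data =
  arrows :: "'g topology"
  units :: "'g set"
  src :: "'g \<Rightarrow> 'g"
  rng :: "'g \<Rightarrow> 'g"
  mult :: "'g \<Rightarrow> 'g \<Rightarrow> 'g"
  ginv :: "'g \<Rightarrow> 'g"

abbreviation Arr :: "('g, 'm) groupoid_data_scheme \<Rightarrow> 'g set" where
  "Arr G \<equiv> topspace (arrows G)"

locale groupoid =
  fixes G :: "('g, 'm) groupoid_data_scheme"
  assumes units_subset: "units G \<subseteq> Arr G"
    and src_in: "\<xi> \<in> Arr G \<Longrightarrow> src G \<xi> \<in> units G"
    and rng_in: "\<xi> \<in> Arr G \<Longrightarrow> rng G \<xi> \<in> units G"
    and src_unit: "x \<in> units G \<Longrightarrow> src G x = x"
    and rng_unit: "x \<in> units G \<Longrightarrow> rng G x = x"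
    and mult_in: "\<lbrakk>\<xi> \<in> Arr G; \<eta> \<in> Arr G; src G \<xi> = rng G \<eta>\<rbrakk> \<Longrightarrow> mult G \<xi> \<eta> \<in> Arr G"
    and src_mult: "\<lbrakk>\<xi> \<in> Arr G; \<eta> \<in> Arr G; src G \<xi> = rng G \<eta>\<rbrakk> \<Longrightarrow> src G (mult G \<xi> \<eta>) = src G \<eta>"
    and rng_mult: "\<lbrakk>\<xi> \<in> Arr G; \<eta> \<in> Arr G; src G \<xi> = rng G \<eta>\<rbrakk> \<Longrightarrow> rng G (mult G \<xi> \<eta>) = rng G \<xi>"
    and mult_assoc: "\<lbrakk>\<xi> \<in> Arr G; \<eta> \<in> Arr G; \<zeta> \<in> Arr G; src G \<xi> = rng G \<eta>; src G \<eta> = rng G \<zeta>\<rbrakk>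
      \<Longrightarrow> mult G (mult G \<xi> \<eta>) \<zeta> = mult G \<xi> (mult G \<eta> \<zeta>)"
    and mult_src: "\<xi> \<in> Arr G \<Longrightarrow> mult G \<xi> (src G \<xi>) = \<xi>"
    and rng_mult_left: "\<xi> \<in> Arr G \<Longrightarrow> mult G (rng G \<xi>) \<xi> = \<xi>"
    and ginv_in: "\<xi> \<in> Arr G \<Longrightarrow> ginv G \<xi> \<in> Arr G"
    and src_ginv: "\<xi> \<in> Arr G \<Longrightarrow> src G (ginv G \<xi>) = rng G \<xi>"
    and rng_ginv: "\<xi> \<in> Arr G \<Longrightarrow> rng G (ginv G \<xi>) = src G \<xi>"
    and ginv_mult: "\<xi> \<in> Arr G \<Longrightarrow> mult G (ginv G \<xi>) \<xi> = src G \<xi>"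
    and mult_ginv: "\<xi> \<in> Arr G \<Longrightarrow> mult G \<xi> (ginv G \<xi>) = rng G \<xi>"

locale topological_groupoid = groupoid G
  for G :: "('g, 'm) groupoid_data_scheme" +
  assumes Hausdorff_arrows: "Hausdorff_space (arrows G)"
    and continuous_ginv: "continuous_map (arrows G) (arrows G) (ginv G)"
    and continuous_mult:
      "continuous_map
         (subtopology (prod_topology (arrows G) (arrows G)) {(\<xi>, \<eta>). src G \<xi> = rng G \<eta>})
         (arrows G) (\<lambda>(\<xi>, \<eta>). mult G \<xi> \<eta>)"

definition source_fibre :: "('g, 'm) groupoid_data_scheme \<Rightarrow> 'g \<Rightarrow> 'g set" where
  "source_fibre G x = {\<xi> \<in> Arr G. src G \<xi> = x}"

definition strongly_noncompact :: "('g, 'm) groupoid_data_scheme \<Rightarrow> bool" where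
  "strongly_noncompact G \<longleftrightarrow> (\<forall>x \<in> units G. \<not> compactin (arrows G) (source_fibre G x))"

locale continuous_groupoid_action = topological_groupoid G
  for G :: "('g, 'm) groupoid_data_scheme" +
  fixes S :: "'s topology"
    and anchor :: "'s \<Rightarrow> 'g"
    and act :: "'g \<Rightarrow> 's \<Rightarrow> 's"
  assumes Hausdorff_S: "Hausdorff_space S"
    and continuous_anchor: "continuous_map S (subtopology (arrows G) (units G)) anchor"
    and anchor_surj: "anchor ` topspace S = units G"
    and continuous_act:
      "continuous_map
         (subtopology (prod_topology (arrows G) S) {(\<xi>, \<sigma>). src G \<xi> = anchor \<sigma>})
         S (\<lambda>(\<xi>, \<sigma>). act \<xi> \<sigma>)"
    and act_unit: "\<sigma> \<in> topspace S \<Longrightarrow> act (anchor \<sigma>) \<sigma> = \<sigma>"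
    and anchor_act: "\<lbrakk>\<xi> \<in> Arr G; \<eta> \<in> Arr G; \<sigma> \<in> topspace S; src G \<xi> = rng G \<eta>; src G \<eta> = anchor \<sigma>\<rbrakk>
      \<Longrightarrow> src G \<xi> = anchor (act \<eta> \<sigma>)"
    and act_mult: "\<lbrakk>\<xi> \<in> Arr G; \<eta> \<in> Arr G; \<sigma> \<in> topspace S; src G \<xi> = rng G \<eta>; src G \<eta> = anchor \<sigma>\<rbrakk>
      \<Longrightarrow> act (mult G \<xi> \<eta>) \<sigma> = act \<xi> (act \<eta> \<sigma>)"

definition translate ::
    "('g, 'm) groupoid_data_scheme \<Rightarrow> ('s \<Rightarrow> 'g) \<Rightarrow> ('g \<Rightarrow> 's \<Rightarrow> 's) \<Rightarrow> 'g \<Rightarrow> 's set \<Rightarrow> 's set" where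
  "translate G anchor act \<xi> M = {act \<xi> \<sigma> | \<sigma>. \<sigma> \<in> M \<and> anchor \<sigma> = src G \<xi>}"

definition recurrence_set ::
    "('g, 'm) groupoid_data_scheme \<Rightarrow> ('s \<Rightarrow> 'g) \<Rightarrow> ('g \<Rightarrow> 's \<Rightarrow> 's) \<Rightarrow> 's set \<Rightarrow> 's set \<Rightarrow> 'g set" where
  "recurrence_set G anchor act M N = {\<xi> \<in> Arr G. translate G anchor act \<xi> M \<inter> N \<noteq> {}}"

text \<open>Neighborhoods are not required to be open.\<close>

definition neighborhood_of_set :: "'a topology \<Rightarrow> 'a set \<Rightarrow> 'a set \<Rightarrow> bool" where
  "neighborhood_of_set T A V \<longleftrightarrow> V \<subseteq> topspace T \<and> (\<exists>U. openin T U \<and> A \<subseteq> U \<and> U \<subseteq> V)"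

definition relatively_compact_in :: "'a topology \<Rightarrow> 'a set \<Rightarrow> bool" where
  "relatively_compact_in T A \<longleftrightarrow> A \<subseteq> topspace T \<and> compactin T (T closure_of A)"

definition wandering ::
    "('g, 'm) groupoid_data_scheme \<Rightarrow> 's topology \<Rightarrow> ('s \<Rightarrow> 'g) \<Rightarrow> ('g \<Rightarrow> 's \<Rightarrow> 's) \<Rightarrow> 's \<Rightarrow> bool" where
  "wandering G S anchor act \<sigma> \<longleftrightarrow>
     (\<exists>W. neighborhood_of_set S {\<sigma>} W
        \<and> relatively_compact_in (arrows G) (recurrence_set G anchor act W W))"

definition nonwandering_set ::
    "('g, 'm) groupoid_data_scheme \<Rightarrow> 's topology \<Rightarrow> ('s \<Rightarrow> 'g) \<Rightarrow> ('g \<Rightarrow> 's \<Rightarrow> 's) \<Rightarrow> 's set" where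
  "nonwandering_set G S anchor act = {\<sigma> \<in> topspace S. \<not> wandering G S anchor act \<sigma>}"

end

theory Submission
  imports Defs
begin

text \<open>
  The idea is that an orbit cannot spend a non-compact amount of time in a region where recurrence
  is relatively compact. Suppose \<open>\<eta>\<close> and \<open>\<xi>\<close> both carry \<open>\<sigma>\<close> into \<open>W\<close>. Then \<open>\<xi>\<eta>\<^sup>-\<^sup>1\<close> carries the point
  \<open>\<eta> \<bullet> \<sigma>\<close> of \<open>W\<close> to the point \<open>\<xi> \<bullet> \<sigma>\<close> of \<open>W\<close>, so it belongs to the recurrence set of \<open>W\<close>. Fixing one
  such \<open>\<eta>\<close>, all other visits \<open>\<xi>\<close> therefore lie in the right translate by \<open>\<eta>\<close> of that recurrence set,
  hence in a compact set as soon as the recurrence set is relatively compact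
  (\<open>visits_in_compact\<close>). Right translation by \<open>\<eta>\<close> is defined only on the arrows whose source is the
  range of \<open>\<eta>\<close>, and it preserves compactness because source fibres are closed
  (\<open>compactin_right_translate\<close>).

  Given an open set \<open>U\<close> containing the non-wandering points, the complement of \<open>U\<close> is compact and
  consists of wandering points, so that finitely many open sets with relatively compact recurrence
  cover it. The arrows that carry \<open>\<sigma>\<close> outside \<open>U\<close> are visits to one of these finitely many sets and
  lie in a finite union of compact sets.
\<close>

context topological_groupoid
begin

text \<open>The source map is continuous because \<open>src G \<xi> = \<xi>\<^sup>-\<^sup>1\<xi>\<close>.\<close>

lemma continuous_map_src: "continuous_map (arrows G) (arrows G) (src G)"
proof -
  have "continuous_map (arrows G)
          (subtopology (prod_topology (arrows G) (arrows G)) {(\<xi>, \<eta>). src G \<xi> = rng G \<eta>})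
          (\<lambda>\<xi>. (ginv G \<xi>, \<xi>))"
    using continuous_ginv src_ginv
    by (auto simp: continuous_map_in_subtopology continuous_map_pairedI)
  from continuous_map_compose[OF this continuous_mult]
  have "continuous_map (arrows G) (arrows G) (\<lambda>\<xi>. mult G (ginv G \<xi>) \<xi>)"
    by (simp add: o_def)
  then show ?thesis
    by (rule continuous_map_eq) (simp add: ginv_mult)
qed

lemma closedin_source_fibre:
  assumes "x \<in> units G"
  shows "closedin (arrows G) (source_fibre G x)"
proof -
  have "closedin (arrows G) {x}"
    using assms units_subset by (intro closedin_Hausdorff_singleton[OF Hausdorff_arrows]) auto
  from closedin_continuous_map_preimage[OF continuous_map_src this]
  show ?thesis
    by (simp add: source_fibre_def)
qed

lemma compactin_right_translate:
  assumes K: "compactin (arrows G) K" and \<eta>: "\<eta> \<in> Arr G"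
  shows "compactin (arrows G) ((\<lambda>\<kappa>. mult G \<kappa> \<eta>) ` (K \<inter> source_fibre G (rng G \<eta>)))"
proof -
  let ?F = "source_fibre G (rng G \<eta>)"
  have "continuous_map (subtopology (arrows G) ?F)
          (subtopology (prod_topology (arrows G) (arrows G)) {(\<xi>, \<eta>). src G \<xi> = rng G \<eta>})
          (\<lambda>\<kappa>. (\<kappa>, \<eta>))"
    using \<eta> by (auto simp: continuous_map_in_subtopology source_fibre_def
        intro!: continuous_map_pairedI continuous_map_from_subtopology)
  from continuous_map_compose[OF this continuous_mult]
  have cont: "continuous_map (subtopology (arrows G) ?F) (arrows G) (\<lambda>\<kappa>. mult G \<kappa> \<eta>)"
    by (simp add: o_def)
  have "compactin (arrows G) (K \<inter> ?F)"
    using compact_Int_closedin[OF K closedin_source_fibre] rng_in[OF \<eta>] by blast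
  then have "compactin (subtopology (arrows G) ?F) (K \<inter> ?F)"
    by (simp add: compactin_subtopology)
  from image_compactin[OF this cont] show ?thesis .
qed

end

context continuous_groupoid_action
begin

lemma act_in:
  assumes "\<xi> \<in> source_fibre G (anchor \<sigma>)" and "\<sigma> \<in> topspace S"
  shows "act \<xi> \<sigma> \<in> topspace S"
  using continuous_map_funspace[OF continuous_act] assms
  by (force simp: source_fibre_def Pi_iff)

lemma anchor_act_eq_rng:
  assumes "\<xi> \<in> source_fibre G (anchor \<sigma>)" and "\<sigma> \<in> topspace S"
  shows "anchor (act \<xi> \<sigma>) = rng G \<xi>"
proof -
  have \<xi>: "\<xi> \<in> Arr G" "src G \<xi> = anchor \<sigma>"
    using assms by (auto simp: source_fibre_def)
  have "rng G \<xi> \<in> units G"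
    using \<xi> rng_in by blast
  \<comment> \<open>The unit at the range of \<open>\<xi>\<close> is composable with \<open>\<xi>\<close>, hence can act on \<open>\<xi> \<bullet> \<sigma>\<close>.\<close>
  then have "src G (rng G \<xi>) = anchor (act \<xi> \<sigma>)"
    using \<xi> assms(2) units_subset src_unit by (intro anchor_act) auto
  then show ?thesis
    using \<open>rng G \<xi> \<in> units G\<close> src_unit by simp
qed

text \<open>The recurrence element is \<open>\<xi>\<eta>\<^sup>-\<^sup>1\<close>, which moves the visit at \<open>\<eta>\<close> to the visit at \<open>\<xi>\<close>.\<close>

lemma visits_in_right_translate:
  assumes \<sigma>: "\<sigma> \<in> topspace S"
    and \<xi>: "\<xi> \<in> source_fibre G (anchor \<sigma>)" "act \<xi> \<sigma> \<in> W"
    and \<eta>: "\<eta> \<in> source_fibre G (anchor \<sigma>)" "act \<eta> \<sigma> \<in> W"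
  shows "\<xi> \<in> (\<lambda>\<kappa>. mult G \<kappa> \<eta>) ` (recurrence_set G anchor act W W \<inter> source_fibre G (rng G \<eta>))"
proof (rule image_eqI)
  define \<kappa> where "\<kappa> = mult G \<xi> (ginv G \<eta>)"
  have arr: "\<xi> \<in> Arr G" "\<eta> \<in> Arr G" and src: "src G \<xi> = anchor \<sigma>" "src G \<eta> = anchor \<sigma>"
    using \<xi> \<eta> by (auto simp: source_fibre_def)
  have \<kappa>: "\<kappa> \<in> Arr G" "src G \<kappa> = rng G \<eta>"
    unfolding \<kappa>_def using arr src by (simp_all add: mult_in src_mult ginv_in rng_ginv src_ginv)
  show eq: "\<xi> = mult G \<kappa> \<eta>"
    unfolding \<kappa>_def using arr src mult_src[of \<xi>]
    by (simp add: mult_assoc ginv_in rng_ginv src_ginv ginv_mult)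
  have "act \<xi> \<sigma> = act \<kappa> (act \<eta> \<sigma>)"
    using act_mult[OF \<kappa>(1) arr(2) \<sigma> \<kappa>(2) src(2)] eq by simp
  moreover have "anchor (act \<eta> \<sigma>) = src G \<kappa>"
    using anchor_act_eq_rng[OF \<eta>(1) \<sigma>] \<kappa> by simp
  ultimately show "\<kappa> \<in> recurrence_set G anchor act W W \<inter> source_fibre G (rng G \<eta>)"
    using \<kappa> \<xi>(2) \<eta>(2) by (auto simp: recurrence_set_def translate_def source_fibre_def)
qed

text \<open>
  A single visit \<open>\<eta>\<close> is used as a base point: all the others lie in the right translate by \<open>\<eta>\<close> of
  the closure of the recurrence set.
\<close>

lemma visits_in_compact:
  assumes \<sigma>: "\<sigma> \<in> topspace S"
    and W: "relatively_compact_in (arrows G) (recurrence_set G anchor act W W)"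
  shows "\<exists>K. compactin (arrows G) K \<and> {\<xi> \<in> source_fibre G (anchor \<sigma>). act \<xi> \<sigma> \<in> W} \<subseteq> K"
proof (cases "{\<xi> \<in> source_fibre G (anchor \<sigma>). act \<xi> \<sigma> \<in> W} = {}")
  case True
  then show ?thesis
    by (intro exI[of _ "{}"]) auto
next
  case False
  then obtain \<eta> where \<eta>: "\<eta> \<in> source_fibre G (anchor \<sigma>)" "act \<eta> \<sigma> \<in> W"
    by blast
  let ?R = "recurrence_set G anchor act W W"
  have "?R \<subseteq> arrows G closure_of ?R" and "compactin (arrows G) (arrows G closure_of ?R)"
    using W by (auto simp: relatively_compact_in_def closure_of_subset)
  moreover have "\<eta> \<in> Arr G"
    using \<eta> by (simp add: source_fibre_def)
  ultimately show ?thesis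
    using visits_in_right_translate[OF \<sigma> _ _ \<eta>] compactin_right_translate
    by (intro exI[of _ "(\<lambda>\<kappa>. mult G \<kappa> \<eta>) ` (arrows G closure_of ?R \<inter> source_fibre G (rng G \<eta>))"])
      blast
qed

text \<open>
  Each point of \<open>C\<close> has an open neighborhood that is visited only by arrows from a compact set, and
  finitely many of these neighborhoods cover \<open>C\<close>.
\<close>

lemma visits_to_compact_wandering_set:
  assumes \<sigma>: "\<sigma> \<in> topspace S"
    and C: "compactin S C"
    and wandering: "\<And>\<tau>. \<tau> \<in> C \<Longrightarrow> wandering G S anchor act \<tau>"
  shows "\<exists>K. compactin (arrows G) K \<and> {\<xi> \<in> source_fibre G (anchor \<sigma>). act \<xi> \<sigma> \<in> C} \<subseteq> K"
proof -
  let ?visits = "\<lambda>W. {\<xi> \<in> source_fibre G (anchor \<sigma>). act \<xi> \<sigma> \<in> W}"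
  define \<O> where "\<O> = {U. openin S U \<and> (\<exists>K. compactin (arrows G) K \<and> ?visits U \<subseteq> K)}"
  have "\<exists>U\<in>\<O>. \<tau> \<in> U" if \<tau>: "\<tau> \<in> C" for \<tau>
  proof -
    obtain W where "neighborhood_of_set S {\<tau>} W"
      and W: "relatively_compact_in (arrows G) (recurrence_set G anchor act W W)"
      using wandering[OF \<tau>] by (auto simp: wandering_def)
    then obtain U where U: "openin S U" "\<tau> \<in> U" "U \<subseteq> W"
      by (auto simp: neighborhood_of_set_def)
    obtain K where "compactin (arrows G) K" "?visits W \<subseteq> K"
      using visits_in_compact[OF \<sigma> W] by blast
    with U have "U \<in> \<O>"
      unfolding \<O>_def by blast
    with U show ?thesis
      by blast
  qed
  then have "C \<subseteq> \<Union>\<O>" and "\<And>U. U \<in> \<O> \<Longrightarrow> openin S U"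
    by (auto simp: \<O>_def)
  then obtain \<F> where \<F>: "finite \<F>" "\<F> \<subseteq> \<O>" "C \<subseteq> \<Union>\<F>"
    using C unfolding compactin_def by meson
  have "\<forall>U\<in>\<F>. \<exists>K. compactin (arrows G) K \<and> ?visits U \<subseteq> K"
    using \<F>(2) by (auto simp: \<O>_def)
  then obtain K where K: "\<And>U. U \<in> \<F> \<Longrightarrow> compactin (arrows G) (K U)"
      "\<And>U. U \<in> \<F> \<Longrightarrow> ?visits U \<subseteq> K U"
    by metis
  have "compactin (arrows G) (\<Union>(K ` \<F>))"
    using \<F>(1) K(1) by (intro compactin_Union) auto
  moreover have "?visits C \<subseteq> \<Union>(K ` \<F>)"
    using \<F>(3) K(2) by blast
  ultimately show ?thesis
    by blast
qed

end

theorem proposition5p17: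
  fixes G :: "('g, 'm) groupoid_data_scheme"
    and S :: "'s topology"
    and anchor :: "'s \<Rightarrow> 'g"
    and act :: "'g \<Rightarrow> 's \<Rightarrow> 's"
  assumes "continuous_groupoid_action G S anchor act"
    and "strongly_noncompact G"
    and "compact_space S"
  shows "\<forall>\<sigma> \<in> topspace S. \<forall>V. neighborhood_of_set S (nonwandering_set G S anchor act) V \<longrightarrow>
           (\<exists>K. compactin (arrows G) K \<and>
                (\<forall>\<xi> \<in> source_fibre G (anchor \<sigma>) - K. act \<xi> \<sigma> \<in> V))"
proof (intro ballI allI impI)
  interpret continuous_groupoid_action G S anchor act
    by (rule assms(1))
  fix \<sigma> V
  assume \<sigma>: "\<sigma> \<in> topspace S"
    and "neighborhood_of_set S (nonwandering_set G S anchor act) V"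
  then obtain U where U: "openin S U" "nonwandering_set G S anchor act \<subseteq> U" "U \<subseteq> V"
    by (auto simp: neighborhood_of_set_def)
  have "compactin S (topspace S - U)"
    using assms(3) U(1) by (intro closedin_compact_space) auto
  moreover have "wandering G S anchor act \<tau>" if "\<tau> \<in> topspace S - U" for \<tau>
    using that U(2) by (auto simp: nonwandering_set_def)
  ultimately obtain K where K: "compactin (arrows G) K"
      "{\<xi> \<in> source_fibre G (anchor \<sigma>). act \<xi> \<sigma> \<in> topspace S - U} \<subseteq> K"
    using visits_to_compact_wandering_set[OF \<sigma>] by meson
  have "act \<xi> \<sigma> \<in> V" if "\<xi> \<in> source_fibre G (anchor \<sigma>) - K" for \<xi>
    using that K(2) U(3) act_in[of \<xi> \<sigma>] \<sigma> by blast
  with K(1) show "\<exists>K. compactin (arrows G) K \<and>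
      (\<forall>\<xi> \<in> source_fibre G (anchor \<sigma>) - K. act \<xi> \<sigma> \<in> V)"
    by blast
qed

end
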